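(* Let $0<q<1$ be fixed. Let $k,l$ be positive integers and $x,y,z$ be real numbers with $|x|,|y|,|z|<1$. Then \begin{align*} &\sum_{m=1}^\infty \frac{\mathrm{Li}_k[x]\zeta_m[l,y]-\mathrm{Li}_l[y]\zeta_m[k,x]}{[m]}z^m \\ =&\mathrm{Li}_l[y]\,S\left[\left.\begin{matrix} 1\\ z\end{matrix}\right|\begin{matrix} k\\ x\end{matrix}\right]-\mathrm{Li}_k[x]\,S\left[\left.\begin{matrix} 1\\ z\end{matrix}\right|\begin{matrix} l\\ y\end{matrix}\right]+\mathrm{Li}_k[x]\mathrm{Li}_{l+1}[zy]-\mathrm{Li}_l[y]\mathrm{Li}_{k+1}[zx]. \end{align*}
   Context: Fix $0<q<1$ and set $[m]=\frac{1-q^m}{1-q}$. For a positive integer $k$ and $-1\le x\le 1$, $\zeta_m[k,x]:=\sum_{j=1}^m\frac{x^j}{[j]^k}$. For $|x|<1$, $\mathrm{Li}_k[x]:=\sum_{m=1}^\infty\frac{x^m}{[m]^k}$. For positive integers $k_1,k$, $x_1\in[-1,1]$ and $x\in(-1,1)$, $S\left[\left.\begin{matrix} k_1\\ x_1\end{matrix}\right|\begin{matrix} k\\ x\end{matrix}\right]:=\sum_{m=1}^\infty\frac{\zeta_m[k_1,x_1]}{[m]^k}x^m$. *)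

theory Defs
  imports Complex_Main
begin

definition qnum :: "real \<Rightarrow> nat \<Rightarrow> real" where
  "qnum q m = (1 - q ^ m) / (1 - q)"

definition qzeta :: "real \<Rightarrow> nat \<Rightarrow> nat \<Rightarrow> real \<Rightarrow> real" where
  "qzeta q m k x = (\<Sum>j = 1..m. x ^ j / qnum q j ^ k)"

(* Series over m \<ge> 1 are written as series over n \<ge> 0 with m = Suc n.  As suminf is
   total, qLi and qS carry their intended meaning only where the series converge:
   for 0 < q < 1 and -1 < x < 1 (and, for qS, also -1 \<le> x1 \<le> 1). *)

definition qLi :: "real \<Rightarrow> nat \<Rightarrow> real \<Rightarrow> real" where
  "qLi q k x = (\<Sum>n. x ^ Suc n / qnum q (Suc n) ^ k)"

definition qS :: "real \<Rightarrow> nat \<Rightarrow> real \<Rightarrow> nat \<Rightarrow> real \<Rightarrow> real" where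
  "qS q k1 x1 k x = (\<Sum>n. qzeta q (Suc n) k1 x1 / qnum q (Suc n) ^ k * x ^ Suc n)"

end

theory Submission
  imports Defs
begin

text \<open>
  For absolutely convergent series \<open>\<Sum>a\<^sub>j\<close> and \<open>\<Sum>b\<^sub>m\<close>, splitting the double sum into the parts
  \<open>j \<le> m\<close> and \<open>m \<le> j\<close>, which overlap in the diagonal, gives
  \<open>\<Sum>\<^sub>m (\<Sum>\<^sub>j\<^sub>\<le>\<^sub>m a\<^sub>j) b\<^sub>m + \<Sum>\<^sub>j (\<Sum>\<^sub>m\<^sub>\<le>\<^sub>j b\<^sub>m) a\<^sub>j = (\<Sum>a)(\<Sum>b) + \<Sum>\<^sub>j a\<^sub>j b\<^sub>j\<close>.
  Apply this with \<open>b\<^sub>m = z\<^sup>m/[m]\<close> to \<open>a\<^sub>j = y\<^sup>j/[j]\<^sup>l\<close> and to \<open>a\<^sub>j = x\<^sup>j/[j]\<^sup>k\<close>, and combine with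
  the weights \<open>Li\<^sub>k[x]\<close> and \<open>-Li\<^sub>l[y]\<close>: the products of the full series cancel.
\<close>

text \<open>Finite form of the splitting: both triangles cover the square \<open>N\<close> by
  \<open>N\<close> and share its diagonal. Being exact for every \<open>N\<close>, it spares any
  rearrangement of a double series.\<close>

lemma sum_partial_sums_mult:
  fixes a b :: "nat \<Rightarrow> 'a::comm_ring"
  shows "(\<Sum>n<N. (\<Sum>j\<le>n. a j) * b n)
           = (\<Sum>n<N. a n) * (\<Sum>n<N. b n) + (\<Sum>n<N. a n * b n) - (\<Sum>n<N. (\<Sum>j\<le>n. b j) * a n)"
proof (induction N)
  case (Suc N)
  \<comment> \<open>Once the diagonal term is split off, the induction step is a ring
    identity.\<close>
  have "(\<Sum>j\<le>N. f j) = (\<Sum>j<N. f j) + f N" for f :: "nat \<Rightarrow> 'a"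
    by (simp flip: lessThan_Suc_atMost)
  with Suc show ?case
    by (simp add: algebra_simps)
qed simp

text \<open>The partial sums of \<open>a\<close> are bounded by the sum of all
  \<open>\<bar>a j\<bar>\<close>, so a multiple of \<open>\<bar>b n\<bar>\<close> dominates.\<close>

lemma summable_partial_sums_mult:
  fixes a b :: "nat \<Rightarrow> real"
  assumes a: "summable (\<lambda>n. \<bar>a n\<bar>)" and b: "summable (\<lambda>n. \<bar>b n\<bar>)"
  shows "summable (\<lambda>n. (\<Sum>j\<le>n. a j) * b n)"
proof (rule summable_comparison_test')
  show "summable (\<lambda>n. (\<Sum>j. \<bar>a j\<bar>) * \<bar>b n\<bar>)"
    using b by (rule summable_mult)
next
  fix n
  have "\<bar>\<Sum>j\<le>n. a j\<bar> \<le> (\<Sum>j\<le>n. \<bar>a j\<bar>)"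
    by (rule sum_abs)
  also have "\<dots> \<le> (\<Sum>j. \<bar>a j\<bar>)"
    using a by (rule sum_le_suminf) auto
  finally show "norm ((\<Sum>j\<le>n. a j) * b n) \<le> (\<Sum>j. \<bar>a j\<bar>) * \<bar>b n\<bar>"
    by (simp add: abs_mult mult_right_mono)
qed

lemma summable_abs_mult:
  fixes a b :: "nat \<Rightarrow> real"
  assumes a: "summable (\<lambda>n. \<bar>a n\<bar>)" and b: "summable (\<lambda>n. \<bar>b n\<bar>)"
  shows "summable (\<lambda>n. a n * b n)"
proof (rule summable_comparison_test')
  show "summable (\<lambda>n. (\<Sum>j. \<bar>a j\<bar>) * \<bar>b n\<bar>)"
    using b by (rule summable_mult)
next
  fix n
  have "\<bar>a n\<bar> \<le> (\<Sum>j. \<bar>a j\<bar>)"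
    using sum_le_suminf[OF a, of "{n}"] by simp
  then show "norm (a n * b n) \<le> (\<Sum>j. \<bar>a j\<bar>) * \<bar>b n\<bar>"
    by (simp add: abs_mult mult_right_mono)
qed

text \<open>Limit of the finite identity: every term on its right converges, hence so does the left
  side.\<close>

lemma partial_sums_mult_sums:
  fixes a b :: "nat \<Rightarrow> real"
  assumes a: "summable (\<lambda>n. \<bar>a n\<bar>)" and b: "summable (\<lambda>n. \<bar>b n\<bar>)"
  shows "(\<lambda>n. (\<Sum>j\<le>n. a j) * b n) sums
           (suminf a * suminf b + (\<Sum>n. a n * b n) - (\<Sum>n. (\<Sum>j\<le>n. b j) * a n))"
proof -
  have "summable a" "summable b"
    using a b by (auto intro: summable_rabs_cancel)
  moreover have "summable (\<lambda>n. a n * b n)"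
    using a b by (rule summable_abs_mult)
  moreover have "summable (\<lambda>n. (\<Sum>j\<le>n. b j) * a n)"
    using b a by (rule summable_partial_sums_mult)
  ultimately show ?thesis
    unfolding sums_def sum_partial_sums_mult[of a b]
    by (intro tendsto_diff tendsto_add tendsto_mult summable_LIMSEQ)
qed

lemma qnum_ge_1:
  assumes "0 < q" "q < 1" "m \<ge> 1"
  shows "qnum q m \<ge> 1"
  using assms power_decreasing[of 1 m q] by (simp add: qnum_def)

text \<open>As \<open>qnum q (Suc n)\<close> is at least 1, the geometric series in
  \<open>\<bar>x\<bar>\<close> dominates.\<close>

lemma summable_abs_qLi:
  assumes "0 < q" "q < 1" "\<bar>x\<bar> < 1"
  shows "summable (\<lambda>n. \<bar>x ^ Suc n / qnum q (Suc n) ^ k\<bar>)"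
proof (rule summable_comparison_test')
  show "summable (\<lambda>n. \<bar>x\<bar> ^ Suc n)"
    using assms by (simp add: summable_geometric)
next
  fix n
  have "1 \<le> qnum q (Suc n) ^ k"
    using assms qnum_ge_1[of q "Suc n"] by (simp add: one_le_power)
  then have "\<bar>x\<bar> ^ Suc n / \<bar>qnum q (Suc n) ^ k\<bar> \<le> \<bar>x\<bar> ^ Suc n"
    using divide_left_mono[of 1 "qnum q (Suc n) ^ k" "\<bar>x\<bar> ^ Suc n"] by simp
  then show "norm \<bar>x ^ Suc n / qnum q (Suc n) ^ k\<bar> \<le> \<bar>x\<bar> ^ Suc n"
    by (simp only: real_norm_def abs_idempotent abs_divide power_abs)
qed

lemma qzeta_Suc: "qzeta q (Suc n) k x = (\<Sum>j\<le>n. x ^ Suc j / qnum q (Suc j) ^ k)"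
  unfolding qzeta_def One_nat_def sum.shift_bounds_cl_Suc_ivl atLeast0AtMost ..

lemma qzeta_series_sums:
  assumes "0 < q" "q < 1" "\<bar>x\<bar> < 1" "\<bar>z\<bar> < 1"
  shows "(\<lambda>n. qzeta q (Suc n) k x / qnum q (Suc n) * z ^ Suc n) sums
           (qLi q k x * qLi q 1 z + qLi q (k + 1) (z * x) - qS q 1 z k x)"
proof -
  define a where "a n = x ^ Suc n / qnum q (Suc n) ^ k" for n
  \<comment> \<open>The exponent 1 gives \<open>b\<close> the shape of the summands of
    \<open>qLi q 1 z\<close>, so \<open>summable_abs_qLi\<close> applies to it.\<close>
  define b where "b n = z ^ Suc n / qnum q (Suc n) ^ 1" for n
  have "(\<lambda>n. (\<Sum>j\<le>n. a j) * b n) sums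
          (suminf a * suminf b + (\<Sum>n. a n * b n) - (\<Sum>n. (\<Sum>j\<le>n. b j) * a n))"
    unfolding a_def b_def using assms by (intro partial_sums_mult_sums summable_abs_qLi)
  moreover have "(\<Sum>j\<le>n. a j) * b n = qzeta q (Suc n) k x / qnum q (Suc n) * z ^ Suc n" for n
    by (simp add: qzeta_Suc a_def b_def)
  moreover have "suminf a = qLi q k x" "suminf b = qLi q 1 z"
    by (simp_all add: qLi_def a_def[abs_def] b_def[abs_def])
  moreover have "(\<Sum>n. a n * b n) = qLi q (k + 1) (z * x)"
    by (simp add: qLi_def a_def b_def power_mult_distrib mult_ac)
  moreover have "(\<Sum>n. (\<Sum>j\<le>n. b j) * a n) = qS q 1 z k x"
    by (simp add: qS_def qzeta_Suc a_def b_def)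
  ultimately show ?thesis by simp
qed

theorem theorem2p2:
  fixes q x y z :: real and k l :: nat
  assumes "0 < q" and "q < 1"
    and "k \<ge> 1" and "l \<ge> 1"
    and "\<bar>x\<bar> < 1" and "\<bar>y\<bar> < 1" and "\<bar>z\<bar> < 1"
  shows "(\<lambda>n. (qLi q k x * qzeta q (Suc n) l y - qLi q l y * qzeta q (Suc n) k x)
              / qnum q (Suc n) * z ^ Suc n)
         sums (qLi q l y * qS q 1 z k x - qLi q k x * qS q 1 z l y
               + qLi q k x * qLi q (l + 1) (z * y) - qLi q l y * qLi q (k + 1) (z * x))"
proof -
  let ?T = "\<lambda>k x n. qzeta q (Suc n) k x / qnum q (Suc n) * z ^ Suc n"
  let ?L = "\<lambda>k x. qLi q k x * qLi q 1 z + qLi q (k + 1) (z * x) - qS q 1 z k x"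
  have "(\<lambda>n. qLi q k x * ?T l y n - qLi q l y * ?T k x n) sums
          (qLi q k x * ?L l y - qLi q l y * ?L k x)"
    using assms by (intro sums_diff sums_mult qzeta_series_sums)
  moreover have "qLi q k x * ?T l y n - qLi q l y * ?T k x n =
      (qLi q k x * qzeta q (Suc n) l y - qLi q l y * qzeta q (Suc n) k x)
        / qnum q (Suc n) * z ^ Suc n" for n
    by (simp only: left_diff_distrib diff_divide_distrib times_divide_eq_right mult.assoc[symmetric])
  \<comment> \<open>The triple product \<open>qLi q k x * qLi q l y * qLi q 1 z\<close> occurs with
    both signs and cancels.\<close>
  moreover have "qLi q k x * ?L l y - qLi q l y * ?L k x =
      qLi q l y * qS q 1 z k x - qLi q k x * qS q 1 z l y
      + qLi q k x * qLi q (l + 1) (z * y) - qLi q l y * qLi q (k + 1) (z * x)"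
    by (simp only: algebra_simps)
  ultimately show ?thesis
    by (simp only:)
qed

end
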